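(* For integers $2\le m\le n$, $strc(K_{m,n})=\lceil \sqrt[m]{n}\,\rceil+1$.
   Context: All graphs are finite and simple; $K_{m,n}$ is the complete bipartite graph with class sizes $m$ and $n$. A total-coloured path (vertices and edges coloured) is total-rainbow if its edges and internal vertices have pairwise distinct colours. $strc(G)$ is the minimum number of colours in a total-colouring of $G$ in which any two vertices $u,v$ are joined by a total-rainbow $u$–$v$ geodesic (a $u$–$v$ path of length $d(u,v)$). *)

theory Defs
  imports "Graph_Theory.Graph_Theory"
begin

text \<open>
  Following the library, a finite simple graph is a symmetric digraph without loops or parallel
  arcs (locale \<^locale>\<open>graph\<close>), each undirected edge \<open>uv\<close> being the pair of arcs \<open>u \<rightarrow> v\<close>, \<open>v \<rightarrow> u\<close>.
  To give an edge a single colour, colourings are defined on the end sets \<open>{u, v}\<close> and not on arcs.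
\<close>

definition edge_of :: "('a, 'b) pre_digraph \<Rightarrow> 'b \<Rightarrow> 'a set" where
  "edge_of G e = {tail G e, head G e}"

definition uedges :: "('a, 'b) pre_digraph \<Rightarrow> 'a set set" where
  "uedges G = edge_of G ` arcs G"

text \<open>A total colouring with colours in \<open>nat\<close>: \<open>Inl\<close> tags vertices, \<open>Inr\<close> tags edges.
  It need not be proper.\<close>

type_synonym 'a total_colouring = "'a + 'a set \<Rightarrow> nat"

definition num_colours :: "('a, 'b) pre_digraph \<Rightarrow> 'a total_colouring \<Rightarrow> nat" where
  "num_colours G c = card (c ` (verts G <+> uedges G))"

definition total_rainbow :: "('a, 'b) pre_digraph \<Rightarrow> 'a total_colouring \<Rightarrow> 'b awalk \<Rightarrow> bool" where
  "total_rainbow G c p \<longleftrightarrow>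
     distinct (map (\<lambda>e. c (Inr (edge_of G e))) p
       @ map (\<lambda>x. c (Inl x)) (pre_digraph.inner_verts G p))"

text \<open>The graph distance is the library's shortest-path distance for unit arc weights.\<close>

definition geodesic :: "('a, 'b) pre_digraph \<Rightarrow> 'a \<Rightarrow> 'b awalk \<Rightarrow> 'a \<Rightarrow> bool" where
  "geodesic G u p v \<longleftrightarrow>
     pre_digraph.apath G u p v \<and> ereal (real (length p)) = wf_digraph.\<mu> G (\<lambda>_. 1) u v"

definition strongly_total_rainbow_connected ::
    "('a, 'b) pre_digraph \<Rightarrow> 'a total_colouring \<Rightarrow> bool" where
  "strongly_total_rainbow_connected G c \<longleftrightarrow>
     (\<forall>u \<in> verts G. \<forall>v \<in> verts G. u \<noteq> v \<longrightarrow> (\<exists>p. geodesic G u p v \<and> total_rainbow G c p))"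

text \<open>Meaningful for connected \<open>G\<close>; otherwise no colouring qualifies.\<close>

definition strc :: "('a, 'b) pre_digraph \<Rightarrow> nat" where
  "strc G = (LEAST k. \<exists>c. strongly_total_rainbow_connected G c \<and> num_colours G c = k)"

end

theory Submission
  imports Defs
begin

text \<open>
  Two vertices of the same class are at distance 2, so their geodesics are the paths through a
  single vertex of the other class. Encode each vertex \<open>v\<close> of the class of size \<open>n\<close> by the vector
  of colours of the \<open>m\<close> edges at \<open>v\<close>. With \<open>k\<close> colours one may, in the coordinate of \<open>u\<close>, replace
  the colour of \<open>u\<close> itself by any other colour: this destroys no rainbow path through \<open>u\<close>, so the
  modified vectors are still distinct and \<open>n \<le> (k - 1)^m\<close>. Conversely, if \<open>n \<le> b^m\<close> and
  \<open>b \<ge> 2\<close>, choose \<open>n\<close> distinct vectors over \<open>b\<close> colours, among them the \<open>m\<close> unit vectors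
  (these provide the rainbow paths inside the class of size \<open>m\<close>), and give all vertices one
  further colour.
\<close>

text \<open>\<open>w\<close> is the only internal vertex of this path, so the colours of
  \<open>u\<close> and \<open>v\<close> do not enter. Using end sets instead of arcs reduces the
  problem to vertices.\<close>

definition rainbow_via :: "'a total_colouring \<Rightarrow> 'a \<Rightarrow> 'a \<Rightarrow> 'a \<Rightarrow> bool" where
  "rainbow_via c u w v \<longleftrightarrow> distinct [c (Inr {u, w}), c (Inr {w, v}), c (Inl w)]"

section \<open>Geodesics of length 1 and 2 in digraphs\<close>

context wf_digraph
begin

lemma awalk_cost_unit: "awalk_cost (\<lambda>_. 1) p = real (length p)"
  by (induct p) auto

lemma unit_distance_eqI:
  assumes "awalk u p v" and "\<And>q. awalk u q v \<Longrightarrow> length p \<le> length q"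
  shows "\<mu> (\<lambda>_. 1) u v = ereal (real (length p))"
  unfolding \<mu>_def awalk_cost_unit using assms by (intro INF_eqI) auto

lemma geodesicI:
  assumes "apath u p v" and "\<And>q. awalk u q v \<Longrightarrow> length p \<le> length q"
  shows "geodesic G u p v"
  using assms unit_distance_eqI[of u p v] by (simp add: geodesic_def apath_def)

lemma geodesic_length_le:
  assumes "geodesic G u p v" and "awalk u q v"
  shows "length p \<le> length q"
proof -
  have "ereal (real (length p)) \<le> ereal (real (length q))"
    using assms min_cost_le_walk_cost[OF assms(2), of "\<lambda>_. 1"]
    by (simp only: geodesic_def awalk_cost_unit)
  then show ?thesis by simp
qed

text \<open>A single arc has one colour and no internal vertex, so adjacent pairs put no condition
  on \<open>c\<close>.\<close>

lemma rainbow_geodesic_adjacent: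
  assumes "u \<rightarrow>\<^bsub>G\<^esub> v" and "u \<noteq> v"
  shows "\<exists>p. geodesic G u p v \<and> total_rainbow G c p"
proof -
  from assms obtain e where e: "e \<in> arcs G" "tail G e = u" "head G e = v" by auto
  have "geodesic G u [e] v"
  proof (rule geodesicI)
    show "apath u [e] v" using e assms by (auto simp: apath_def awalk_def)
    show "length [e] \<le> length q" if "awalk u q v" for q
      using that assms by (cases q) (auto simp: awalk_def)
  qed
  moreover have "total_rainbow G c [e]" by (simp add: total_rainbow_def)
  ultimately show ?thesis by blast
qed

lemma awalk_length_ge_2:
  assumes "awalk u q v" and "u \<noteq> v" and "\<not> u \<rightarrow>\<^bsub>G\<^esub> v"
  shows "2 \<le> length q"
proof (cases q)
  case Nil
  then show ?thesis using assms by (simp add: awalk_def)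
next
  case (Cons e r)
  have "r \<noteq> []"
  proof
    assume "r = []"
    with Cons assms(1) have "e \<in> arcs G" "arc_to_ends G e = (u, v)"
      by (auto simp: awalk_def arc_to_ends_def)
    then show False using assms(3) dominatesI by blast
  qed
  then show ?thesis using Cons by (cases r) auto
qed

text \<open>The common neighbour \<open>x\<close> makes the distance exactly 2, so every geodesic
  consists of two arcs through some middle vertex \<open>w\<close>. By \<open>loopfree\<close>,
  \<open>w\<close> differs from both ends, so each such walk is a path.\<close>

lemma rainbow_geodesic_distance_2:
  assumes "u \<noteq> v" and "\<not> u \<rightarrow>\<^bsub>G\<^esub> v" and loopfree: "\<And>x. \<not> x \<rightarrow>\<^bsub>G\<^esub> x"
    and common: "u \<rightarrow>\<^bsub>G\<^esub> x" "x \<rightarrow>\<^bsub>G\<^esub> v"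
  shows "(\<exists>p. geodesic G u p v \<and> total_rainbow G c p)
    \<longleftrightarrow> (\<exists>w. u \<rightarrow>\<^bsub>G\<^esub> w \<and> w \<rightarrow>\<^bsub>G\<^esub> v \<and> rainbow_via c u w v)"
proof -
  have path: "\<exists>e f. apath u [e, f] v \<and> tail G e = u \<and> head G e = w \<and> tail G f = w \<and> head G f = v"
    if w: "u \<rightarrow>\<^bsub>G\<^esub> w" "w \<rightarrow>\<^bsub>G\<^esub> v" for w
  proof -
    from w obtain e f where "e \<in> arcs G" "tail G e = u" "head G e = w"
      "f \<in> arcs G" "tail G f = w" "head G f = v" by (metis reachableE)
    moreover have "u \<noteq> w" "w \<noteq> v" using w loopfree by auto
    ultimately show ?thesis
      using assms(1) by (intro exI[of _ e] exI[of _ f]) (auto simp: apath_def awalk_def)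
  qed
  show ?thesis
  proof
    assume "\<exists>p. geodesic G u p v \<and> total_rainbow G c p"
    then obtain p where p: "geodesic G u p v" "total_rainbow G c p" by blast
    from path[OF common] obtain e f where q: "awalk u [e, f] v"
      unfolding apath_def by blast
    have walk: "awalk u p v" using p by (simp add: geodesic_def apath_def)
    have "length p = 2"
      using geodesic_length_le[OF p(1) q] awalk_length_ge_2[OF walk assms(1,2)] by simp
    then obtain e f where ef: "p = [e, f]"
      by (auto simp: numeral_2_eq_2 length_Suc_conv)
    have *: "e \<in> arcs G" "f \<in> arcs G" "tail G e = u" "tail G f = head G e" "head G f = v"
      using walk ef by (auto simp: awalk_def)
    have "u \<rightarrow>\<^bsub>G\<^esub> head G e" "head G e \<rightarrow>\<^bsub>G\<^esub> v"
      using * dominatesI[of e] dominatesI[of f] by (auto simp: arc_to_ends_def)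
    moreover have "rainbow_via c u (head G e) v"
      using p(2) * by (simp add: ef total_rainbow_def rainbow_via_def edge_of_def inner_verts_def)
    ultimately show "\<exists>w. u \<rightarrow>\<^bsub>G\<^esub> w \<and> w \<rightarrow>\<^bsub>G\<^esub> v \<and> rainbow_via c u w v" by blast
  next
    assume "\<exists>w. u \<rightarrow>\<^bsub>G\<^esub> w \<and> w \<rightarrow>\<^bsub>G\<^esub> v \<and> rainbow_via c u w v"
    then obtain w where w: "u \<rightarrow>\<^bsub>G\<^esub> w" "w \<rightarrow>\<^bsub>G\<^esub> v" "rainbow_via c u w v" by blast
    from path[OF w(1,2)] obtain e f where ef: "apath u [e, f] v" "tail G e = u" "head G e = w"
      "tail G f = w" "head G f = v" by blast
    have "geodesic G u [e, f] v"
      using awalk_length_ge_2[OF _ assms(1,2)]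
      by (intro geodesicI ef) (simp add: numeral_2_eq_2)
    moreover have "total_rainbow G c [e, f]"
      using w(3) ef by (simp add: total_rainbow_def rainbow_via_def edge_of_def inner_verts_def)
    ultimately show "\<exists>p. geodesic G u p v \<and> total_rainbow G c p" by blast
  qed
qed

end

section \<open>Complete bipartite graphs with fixed classes\<close>

locale complete_bipartite = graph G for G :: "('a, 'b) pre_digraph" +
  fixes U V :: "'a set"
  assumes verts: "verts G = U \<union> V" and disjoint: "U \<inter> V = {}"
    and arcs_ends: "arcs_ends G = U \<times> V \<union> V \<times> U"
    and nonempty: "U \<noteq> {}" "V \<noteq> {}"
begin

lemma finite_classes: "finite U" "finite V"
  using finite_verts verts by auto

text \<open>Pairs from different classes are adjacent and thus harmless. Two vertices of one class
  are non-adjacent and have \<open>a\<close> or \<open>b\<close> as a common neighbour, so they are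
  at distance 2.\<close>

lemma strongly_total_rainbow_connected_iff:
  "strongly_total_rainbow_connected G c \<longleftrightarrow>
     (\<forall>u\<in>U. \<forall>v\<in>U. u \<noteq> v \<longrightarrow> (\<exists>w\<in>V. rainbow_via c u w v)) \<and>
     (\<forall>u\<in>V. \<forall>v\<in>V. u \<noteq> v \<longrightarrow> (\<exists>w\<in>U. rainbow_via c u w v))"
proof -
  let ?R = "\<lambda>u v. \<exists>p. geodesic G u p v \<and> total_rainbow G c p"
  obtain a b where ab: "a \<in> U" "b \<in> V" using nonempty by blast
  have dom: "u \<rightarrow>\<^bsub>G\<^esub> v \<longleftrightarrow> u \<in> U \<and> v \<in> V \<or> u \<in> V \<and> v \<in> U" for u v
    by (auto simp: arcs_ends)
  have UU: "?R u v \<longleftrightarrow> (\<exists>w\<in>V. rainbow_via c u w v)" if "u \<in> U" "v \<in> U" "u \<noteq> v" for u v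
    by (subst rainbow_geodesic_distance_2[of _ _ b]) (use that ab disjoint in \<open>auto simp: dom\<close>)
  have VV: "?R u v \<longleftrightarrow> (\<exists>w\<in>U. rainbow_via c u w v)" if "u \<in> V" "v \<in> V" "u \<noteq> v" for u v
    by (subst rainbow_geodesic_distance_2[of _ _ a]) (use that ab disjoint in \<open>auto simp: dom\<close>)
  have UV: "?R u v" if "u \<in> U \<and> v \<in> V \<or> u \<in> V \<and> v \<in> U" for u v
    by (rule rainbow_geodesic_adjacent) (use that disjoint in \<open>auto simp: dom\<close>)
  show ?thesis
    unfolding strongly_total_rainbow_connected_def verts ball_Un
    using UU VV UV by auto
qed

lemma uedges_eq: "uedges G = (\<lambda>(u, v). {u, v}) ` (U \<times> V)"
proof -
  have "uedges G = (\<lambda>(u, v). {u, v}) ` arcs_ends G"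
    by (auto simp: uedges_def edge_of_def arcs_ends_conv image_image)
  also have "\<dots> = (\<lambda>(u, v). {u, v}) ` (U \<times> V)"
    unfolding arcs_ends by (auto simp: insert_commute image_iff)
  finally show ?thesis .
qed

lemma card_le_num_colours_power:
  assumes c: "strongly_total_rainbow_connected G c" and "2 \<le> card V"
  shows "card V \<le> (num_colours G c - 1) ^ card U \<and> 1 \<le> num_colours G c"
proof -
  define C where "C = c ` (verts G <+> uedges G)"
  have "finite C"
    unfolding C_def uedges_eq verts using finite_classes by (intro finite_imageI finite_Plus) auto
  have vertex: "c (Inl u) \<in> C" if "u \<in> U" for u
    using that by (auto simp: C_def verts)
  have edge: "c (Inr {u, v}) \<in> C" if "u \<in> U" "v \<in> V" for u v
    using that by (auto simp: C_def uedges_eq)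
  have rb: "\<exists>w\<in>U. rainbow_via c u w v" if "u \<in> V" "v \<in> V" "u \<noteq> v" for u v
    using c that strongly_total_rainbow_connected_iff by blast
  obtain x y where xy: "x \<in> V" "y \<in> V" "x \<noteq> y"
    using assms(2) by (metis card_le_Suc0_iff_eq finite_classes(2) not_less_eq_eq numeral_2_eq_2)
  from rb[OF xy] obtain w where w: "w \<in> U" "rainbow_via c x w y" by blast
  \<comment> \<open>The path through \<open>w\<close> has an edge coloured differently from
    \<open>w\<close>, so \<open>C\<close> has two colours and any \<open>k\<close> can be
    avoided.\<close>
  have "\<exists>d\<in>C. d \<noteq> k" for k
    using edge[OF w(1) xy(1)] vertex[OF w(1)] w(2)
    by (cases "k = c (Inl w)") (auto simp: rainbow_via_def insert_commute)
  then obtain d where d: "\<And>k. d k \<in> C" "\<And>k. d k \<noteq> k" by metis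
  define g where "g v = (\<lambda>u\<in>U. if c (Inr {u, v}) = c (Inl u) then d (c (Inl u)) else c (Inr {u, v}))" for v
  have "g ` V \<subseteq> (\<Pi>\<^sub>E u\<in>U. C - {c (Inl u)})"
    using d edge by (auto simp: g_def split: if_splits)
  moreover have "inj_on g V"
  proof (rule inj_onI, rule ccontr)
    fix x y assume *: "x \<in> V" "y \<in> V" "g x = g y" "x \<noteq> y"
    from rb[OF *(1,2,4)] obtain w where w: "w \<in> U" "rainbow_via c x w y" by blast
    \<comment> \<open>Neither edge of a rainbow path through \<open>w\<close> has the colour of
      \<open>w\<close>, so coordinate \<open>w\<close> was left unchanged in both vectors, and the
      two edge colours differ.\<close>
    then have "g x w \<noteq> g y w"
      by (auto simp: g_def rainbow_via_def insert_commute)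
    then show False using *(3) by simp
  qed
  ultimately have "card V \<le> card (\<Pi>\<^sub>E u\<in>U. C - {c (Inl u)})"
    using \<open>finite C\<close> finite_classes by (intro card_inj_on_le[of g] finite_PiE) auto
  also have "\<dots> = (card C - 1) ^ card U"
    using vertex \<open>finite C\<close> finite_classes by (simp add: card_PiE)
  finally have "card V \<le> (card C - 1) ^ card U" .
  \<comment> \<open>This ensures that \<open>card C - 1\<close> is not a truncated
    difference.\<close>
  moreover have "1 \<le> card C"
    using d(1) \<open>finite C\<close> by (metis One_nat_def Suc_leI card_gt_0_iff empty_iff)
  ultimately show ?thesis by (simp add: num_colours_def C_def)
qed

lemma exists_separating_vectors:
  assumes "card U \<le> card V" and "card V \<le> b ^ card U" and "2 \<le> b"
  obtains f where "inj_on f V" and "f ` V \<subseteq> (\<Pi>\<^sub>E u\<in>U. {..<b})"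
    and "\<And>u u'. u \<in> U \<Longrightarrow> u' \<in> U \<Longrightarrow> u \<noteq> u' \<Longrightarrow> \<exists>v\<in>V. f v u \<noteq> f v u'"
proof -
  \<comment> \<open>The unit vector \<open>e u\<close> separates coordinate \<open>u\<close> from
    every other; \<open>2 \<le> b\<close> admits its entries 0 and 1.\<close>
  define e where "e u = (\<lambda>u'\<in>U. if u' = u then 1 else 0 :: nat)" for u
  have "inj_on e U"
  proof (rule inj_onI)
    fix u u' assume "u \<in> U" "u' \<in> U" "e u = e u'"
    then show "u = u'" by (auto simp: e_def dest: fun_cong[of _ _ u] split: if_splits)
  qed
  then have "card (e ` U) \<le> card V" using assms(1) by (simp add: card_image)
  moreover have "e ` U \<subseteq> (\<Pi>\<^sub>E u\<in>U. {..<b})" using assms(3) by (auto simp: e_def)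
  moreover have "card V \<le> card (\<Pi>\<^sub>E u\<in>U. {..<b})" using assms(2) finite_classes by (simp add: card_PiE)
  moreover have "finite (\<Pi>\<^sub>E u\<in>U. {..<b})" using finite_classes by (intro finite_PiE) auto
  \<comment> \<open>The two cardinality bounds leave room for a set of exactly \<open>card V\<close>
    vectors containing all unit vectors.\<close>
  ultimately obtain S where S: "e ` U \<subseteq> S" "S \<subseteq> (\<Pi>\<^sub>E u\<in>U. {..<b})" "card S = card V"
    using exists_subset_between by metis
  have "finite S" using S(2) \<open>finite (\<Pi>\<^sub>E u\<in>U. {..<b})\<close> by (rule finite_subset)
  with S(3) obtain f where f: "bij_betw f V S"
    using finite_classes(2) finite_same_card_bij by metis
  show thesis
  proof
    show "inj_on f V" "f ` V \<subseteq> (\<Pi>\<^sub>E u\<in>U. {..<b})" using f S by (auto simp: bij_betw_def)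
    fix u u' assume *: "u \<in> U" "u' \<in> U" "u \<noteq> u'"
    then have "e u \<in> f ` V" using S f by (auto simp: bij_betw_def)
    then obtain v where "v \<in> V" "f v = e u" by auto
    then show "\<exists>v\<in>V. f v u \<noteq> f v u'" using * by (intro bexI[of _ v]) (auto simp: e_def)
  qed
qed

lemma exists_colouring:
  assumes "card U \<le> card V" and "card V \<le> b ^ card U" and "2 \<le> b"
  obtains c where "strongly_total_rainbow_connected G c" and "num_colours G c \<le> b + 1"
proof -
  obtain f where f: "inj_on f V" "f ` V \<subseteq> (\<Pi>\<^sub>E u\<in>U. {..<b})"
    "\<And>u u'. u \<in> U \<Longrightarrow> u' \<in> U \<Longrightarrow> u \<noteq> u' \<Longrightarrow> \<exists>v\<in>V. f v u \<noteq> f v u'"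
    using exists_separating_vectors[OF assms] by blast
  \<comment> \<open>Intersecting an edge with the classes recovers its two ends. Values at sets that
    are not edges are arbitrary and never counted. The vertex colour \<open>b\<close> lies outside
    the range of the vector entries.\<close>
  define c :: "'a total_colouring" where
    "c = case_sum (\<lambda>_. b) (\<lambda>e. f (the_elem (e \<inter> V)) (the_elem (e \<inter> U)))"
  have vertex: "c (Inl x) = b" for x by (simp add: c_def)
  have edge: "c (Inr {u, v}) = f v u" "c (Inr {v, u}) = f v u" if "u \<in> U" "v \<in> V" for u v
  proof -
    have "{u, v} \<inter> V = {v}" "{u, v} \<inter> U = {u}" using that disjoint by auto
    then show "c (Inr {u, v}) = f v u" by (simp add: c_def)
    then show "c (Inr {v, u}) = f v u" by (simp add: insert_commute)
  qed
  have bound: "f v u < b" if "u \<in> U" "v \<in> V" for u v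
    using f(2) that by (auto simp: PiE_iff image_subset_iff)
  have "strongly_total_rainbow_connected G c"
    unfolding strongly_total_rainbow_connected_iff
  proof (intro conjI ballI impI)
    fix u u' assume *: "u \<in> U" "u' \<in> U" "u \<noteq> u'"
    from f(3)[OF this] obtain v where "v \<in> V" "f v u \<noteq> f v u'" by blast
    then show "\<exists>w\<in>V. rainbow_via c u w u'"
      using * bound[of u v] bound[of u' v]
      by (intro bexI[of _ v]) (auto simp: rainbow_via_def edge vertex)
  next
    fix v v' assume *: "v \<in> V" "v' \<in> V" "v \<noteq> v'"
    then have "f v \<noteq> f v'" using f(1) by (auto dest: inj_onD)
    \<comment> \<open>The vectors agree outside \<open>U\<close>, so they must differ at a
      coordinate in \<open>U\<close>.\<close>
    moreover have "f v \<in> extensional U" "f v' \<in> extensional U"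
      using f(2) * by (auto simp: PiE_iff image_subset_iff)
    ultimately obtain u where "u \<in> U" "f v u \<noteq> f v' u" by (meson extensionalityI)
    then show "\<exists>w\<in>U. rainbow_via c v w v'"
      using * bound[of u v] bound[of u v']
      by (intro bexI[of _ u]) (auto simp: rainbow_via_def edge vertex)
  qed
  moreover have "c ` (verts G <+> uedges G) \<subseteq> {..b}"
    using bound by (auto simp: uedges_eq edge vertex less_imp_le)
  then have "num_colours G c \<le> b + 1"
    unfolding num_colours_def using card_mono[OF finite_atMost] by fastforce
  ultimately show thesis by (rule that)
qed

lemma strc_eq:
  assumes "2 \<le> card U" and "card U \<le> card V"
  shows "int (strc G) = \<lceil>root (card U) (real (card V))\<rceil> + 1"
proof -
  let ?m = "card U" and ?n = "card V"
  define b where "b = nat \<lceil>root ?m (real ?n)\<rceil>"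
  \<comment> \<open>The strict bound makes the ceiling at least 2, as the construction of the
    colouring requires.\<close>
  have "1 < root ?m (real ?n)" using assms by simp
  then have b: "int b = \<lceil>root ?m (real ?n)\<rceil>" "2 \<le> b"
    unfolding b_def by linarith+
  have "real ?n = root ?m (real ?n) ^ ?m" using assms by simp
  also have "\<dots> \<le> real b ^ ?m"
    unfolding b_def by (intro power_mono real_nat_ceiling_ge real_root_ge_zero) simp
  finally have "real ?n \<le> real (b ^ ?m)" by simp
  then have "?n \<le> b ^ ?m" by (simp only: of_nat_le_iff)
  then obtain c where c: "strongly_total_rainbow_connected G c" "num_colours G c \<le> b + 1"
    using exists_colouring[OF assms(2) _ b(2)] by blast
  let ?P = "\<lambda>k. \<exists>c. strongly_total_rainbow_connected G c \<and> num_colours G c = k"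
  \<comment> \<open>The constructed colouring shows that the minimum exists, so an optimal
    \<open>c'\<close> can be chosen for the lower bound.\<close>
  have "?P (num_colours G c)" using c(1) by blast
  then have "?P (strc G)" and "strc G \<le> num_colours G c"
    unfolding strc_def by (rule LeastI, rule Least_le)
  from \<open>?P (strc G)\<close> obtain c' where c': "strongly_total_rainbow_connected G c'" "num_colours G c' = strc G"
    by blast
  have lower: "?n \<le> (strc G - 1) ^ ?m" "1 \<le> strc G"
    using card_le_num_colours_power[OF c'(1)] c'(2) assms by auto
  have "real ?n \<le> real ((strc G - 1) ^ ?m)" using lower(1) by (simp only: of_nat_le_iff)
  then have "root ?m (real ?n) \<le> root ?m (real (strc G - 1) ^ ?m)"
    using assms by (intro real_root_le_mono) simp_all
  also have "\<dots> = real (strc G - 1)"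
    using assms by (intro real_root_power_cancel) auto
  \<comment> \<open>The root is bounded by an integer, so its ceiling is too.\<close>
  finally have "\<lceil>root ?m (real ?n)\<rceil> \<le> int (strc G - 1)" by (simp add: ceiling_le_iff)
  moreover have "strc G \<le> b + 1"
    using \<open>strc G \<le> num_colours G c\<close> c(2) by simp
  ultimately show ?thesis using b lower(2) by linarith
qed

end

theorem theorem3p7:
  fixes G :: "('a, 'b) pre_digraph" and m n :: nat
  assumes "2 \<le> m" and "m \<le> n"
    and "K\<^bsub>m,n\<^esub> G"
  shows "int (strc G) = \<lceil>root m (real n)\<rceil> + 1"
proof -
  from assms(3) obtain U V where UV: "graph G" "verts G = U \<union> V" "U \<inter> V = {}"
    "card U = m" "card V = n" "arcs_ends G = U \<times> V \<union> V \<times> U"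
    unfolding complete_bipartite_digraph_def by blast
  have "U \<noteq> {}" "V \<noteq> {}" using UV assms by auto
  with UV interpret complete_bipartite G U V
    by (intro complete_bipartite.intro complete_bipartite_axioms.intro) auto
  show ?thesis using strc_eq assms UV by simp
qed

end
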